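(* Let $p:\mathbb{R}^n\to\mathbb{R}$ be a cubic polynomial with a local minimum. Then the following three sets are equal: \begin{itemize} \item[(i)] $LM_p$, the set of local minima of $p$; \item[(ii)] $ri(SO_p)$, the relative interior of the set $SO_p$ of second-order points of $p$; \item[(iii)] the intersection of the set of critical points of $p$ with $ri(CR_p)$, the relative interior of the convexity region $CR_p$ of $p$. \end{itemize}
   Context: A cubic polynomial is a real polynomial all of whose monomials have degree at most 3. A critical point of $p$ is a point $x$ with $\nabla p(x)=0$; a second-order point is a critical point $x$ with $\nabla^2 p(x)\succeq 0$ (positive semidefinite). A point $\bar x$ is a local minimum of $p$ if there is $\epsilon>0$ such that $p(\bar x)\le p(y)$ for all $y$ with $\|y-\bar x\|\le\epsilon$. The convexity region of $p$ is $CR_p=\{x\in\mathbb{R}^n \mid \nabla^2 p(x)\succeq 0\}$. The relative interior of a nonempty convex set $S\subseteq\mathbb{R}^n$ is $ri(S)=\{x\in S \mid \forall y\in S,\ \exists\lambda>1 \text{ such that } \lambda x+(1-\lambda)y\in S\}$. *)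

theory Defs
  imports "HOL-Analysis.Analysis"
begin

text \<open>A monomial in the coordinates of \<open>\<real>\<^sup>n\<close> is represented by its exponent function
  \<open>m\<close>, standing for \<open>\<Prod>i. x\<^sub>i ^ m i\<close>; its degree is \<open>\<Sum>i. m i\<close>.\<close>

definition monomials_le :: "nat \<Rightarrow> ('n::finite \<Rightarrow> nat) set"
  where "monomials_le d = {m. (\<Sum>i\<in>UNIV. m i) \<le> d}"

lemma finite_monomials_le: "finite (monomials_le d :: ('n::finite \<Rightarrow> nat) set)"
proof (rule finite_subset)
  show "(monomials_le d :: ('n \<Rightarrow> nat) set) \<subseteq> PiE UNIV (\<lambda>_. {..d})"
  proof
    fix m :: "'n \<Rightarrow> nat" assume m: "m \<in> monomials_le d"
    have "m i \<le> d" for i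
      using member_le_sum[of i UNIV m] m by (simp add: monomials_le_def)
    then show "m \<in> PiE UNIV (\<lambda>_. {..d})" by auto
  qed
  show "finite (PiE (UNIV :: 'n set) (\<lambda>_. {..d}))"
    by (rule finite_PiE) auto
qed

text \<open>The degree is at most three, not necessarily equal to three.\<close>

definition cubic_polynomial :: "(real ^ 'n \<Rightarrow> real) \<Rightarrow> bool"
  where "cubic_polynomial p \<longleftrightarrow>
    (\<exists>c :: ('n \<Rightarrow> nat) \<Rightarrow> real.
      \<forall>x. p x = (\<Sum>m\<in>monomials_le 3. c m * (\<Prod>i\<in>UNIV. (x $ i) ^ m i)))"

definition gradient :: "(real ^ 'n \<Rightarrow> real) \<Rightarrow> real ^ 'n \<Rightarrow> real ^ 'n"
  where "gradient p x = (THE D. GDERIV p x :> D)"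

lemma gradient_eqI:
  assumes "GDERIV p x :> D"
  shows "gradient p x = D"
  unfolding gradient_def
proof (rule the_equality)
  show "GDERIV p x :> D" by fact
  fix D' assume "GDERIV p x :> D'"
  then have "(\<lambda>h. h \<bullet> D') = (\<lambda>h. h \<bullet> D)"
    using assms unfolding gderiv_def by (rule has_derivative_unique)
  then have "\<forall>h. h \<bullet> D' = h \<bullet> D"
    by (simp add: fun_eq_iff)
  then show "D' = D"
    using vector_eq_ldot[of D' D] by (simp add: inner_commute)
qed

definition hessian :: "(real ^ 'n \<Rightarrow> real) \<Rightarrow> real ^ 'n \<Rightarrow> real ^ 'n ^ 'n"
  where "hessian p x = jacobian (gradient p) (at x)"

definition pos_semidef :: "real ^ 'n ^ 'n \<Rightarrow> bool"
  where "pos_semidef A \<longleftrightarrow> transpose A = A \<and> (\<forall>v. 0 \<le> v \<bullet> (A *v v))"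

definition critical_points :: "(real ^ 'n \<Rightarrow> real) \<Rightarrow> (real ^ 'n) set"
  where "critical_points p = {x. gradient p x = 0}"

definition second_order_points :: "(real ^ 'n \<Rightarrow> real) \<Rightarrow> (real ^ 'n) set"
  where "second_order_points p = {x \<in> critical_points p. pos_semidef (hessian p x)}"

definition local_minima :: "(real ^ 'n \<Rightarrow> real) \<Rightarrow> (real ^ 'n) set"
  where "local_minima p = {x. \<exists>\<epsilon>>0. \<forall>y. norm (y - x) \<le> \<epsilon> \<longrightarrow> p x \<le> p y}"

definition convexity_region :: "(real ^ 'n \<Rightarrow> real) \<Rightarrow> (real ^ 'n) set"
  where "convexity_region p = {x. pos_semidef (hessian p x)}"

text \<open>For nonempty convex sets, the library's \<^const>\<open>rel_interior\<close> (interior relative to the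
  affine hull) is the relative interior given by prolongation of segments.\<close>

lemma rel_interior_eq_prolongation:
  fixes S :: "(real ^ 'n) set"
  assumes "convex S" and "S \<noteq> {}"
  shows "rel_interior S = {x \<in> S. \<forall>y\<in>S. \<exists>t>1. t *\<^sub>R x + (1 - t) *\<^sub>R y \<in> S}"
proof -
  have "x \<in> rel_interior S \<longleftrightarrow> (\<forall>y\<in>S. \<exists>t>1. t *\<^sub>R x + (1 - t) *\<^sub>R y \<in> S)" for x
    unfolding convex_rel_interior_iff[OF assms] by (simp only: add.commute)
  then show ?thesis
    using rel_interior_subset[of S] by (intro set_eqI) (simp, blast)
qed

end

theory Submission
  imports Defs
begin

text \<open>Write \<open>p\<close> as a constant plus \<open>b \<bullet> x + M x \<bullet> x / 2 + q x x \<bullet> x / 6\<close> with \<open>M\<close> self-adjoint and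
  \<open>q\<close> bilinear and totally symmetric, so that the Hessian \<open>H\<^sub>x = M + q x\<close> is affine in \<open>x\<close>.
  A second-order point \<open>x\<close> is a local minimum iff \<open>q d d = 0\<close> for all \<open>d \<in> ker H\<^sub>x\<close>. Indeed, if \<open>x\<close>
  is a local minimum, then \<open>p\<close> is constant on \<open>x + \<real>d\<close>, so the points \<open>x + s d\<close> with \<open>s\<close> small are
  local minima as well and the gradient \<open>s\<^sup>2 q d d / 2\<close> vanishes there; conversely, splitting
  \<open>v = d + z\<close> along \<open>ker H\<^sub>x\<close> and its complement leaves in \<open>p (x + v) - p x\<close> only terms that are
  quadratic in \<open>z\<close>, of which \<open>H\<^sub>x z \<bullet> z / 2\<close> dominates.

  At a local minimum \<open>x\<close>, the same splitting shows that \<open>H\<^sub>x - \<epsilon> q (y - x)\<close> stays positive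
  semidefinite for every \<open>y\<close> in the convexity region. The line through two second-order points is
  critical, which carries prolongations in the convexity region over to second-order points.
  Finally, if a second-order point \<open>x\<close> lies strictly between a local minimum \<open>x\<^sub>0\<close> and another
  second-order point, then \<open>ker H\<^sub>x \<subseteq> ker H\<^bsub>x\<^sub>0\<^esub>\<close>, so the criterion passes from \<open>x\<^sub>0\<close> to \<open>x\<close>.\<close>

section \<open>Positive semidefinite operators\<close>

text \<open>Along \<open>v + s *\<^sub>R S v\<close> the form is a nonnegative polynomial in
  \<open>s\<close> without constant term, so its linear coefficient, twice the squared norm of
  \<open>S v\<close>, must vanish.\<close>

lemma psd_operator_kernel:
  fixes S :: "'a::real_inner \<Rightarrow> 'a"
  assumes lin: "linear S" and sym: "\<And>u v. S u \<bullet> v = u \<bullet> S v"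
    and psd: "\<And>v. 0 \<le> S v \<bullet> v" and zero: "S v \<bullet> v = 0"
  shows "S v = 0"
proof -
  define a where "a = S v \<bullet> S v"
  define k where "k = S (S v) \<bullet> S v"
  have k0: "k \<ge> 0" unfolding k_def by (rule psd)
  have f: "0 \<le> 2 * s * a + s^2 * k" for s
  proof -
    have "0 \<le> S (v + s *\<^sub>R S v) \<bullet> (v + s *\<^sub>R S v)" by (rule psd)
    also have "\<dots> = S v \<bullet> v + s * (S (S v) \<bullet> v) + s * a + s^2 * k"
      by (simp add: linear_add[OF lin] linear_scale[OF lin] inner_add_left inner_add_right
          a_def k_def power2_eq_square algebra_simps)
    also have "S (S v) \<bullet> v = a" by (simp add: sym a_def)
    finally show ?thesis using zero by (simp add: mult_ac)
  qed
  \<comment> \<open>At \<open>s = - r\<close> the linear term outweighs the quadratic one; the added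
    1 keeps the divisor positive when \<open>k = 0\<close>.\<close>
  define r where "r = a / (k + 1)"
  have a: "a = r * (k + 1)" using k0 by (simp add: r_def)
  have "0 \<le> 2 * (- r) * a + (- r)^2 * k" by (rule f)
  also have "\<dots> = - (r^2 * (k + 2))"
    unfolding a by (simp add: algebra_simps power2_eq_square)
  finally have "r = 0" using k0 by (simp add: mult_le_0_iff)
  then have "a = 0" using a by simp
  then show ?thesis by (simp add: a_def)
qed

text \<open>By compactness the form has a positive minimum on the unit sphere of the orthogonal
  complement of the kernel; homogeneity extends the bound to the whole complement.\<close>

lemma psd_operator_coercive:
  fixes S :: "'a::euclidean_space \<Rightarrow> 'a"
  assumes lin: "linear S" and sym: "\<And>u v. S u \<bullet> v = u \<bullet> S v"
    and psd: "\<And>v. 0 \<le> S v \<bullet> v"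
  obtains \<mu> where "\<mu> > 0"
    "\<And>v. \<exists>d z. v = d + z \<and> S d = 0 \<and> norm d \<le> norm v \<and> norm z \<le> norm v \<and>
      \<mu> * (norm z)\<^sup>2 \<le> S z \<bullet> z"
proof -
  define N where "N = {d. S d = 0}"
  have N: "subspace N" unfolding N_def by (rule linear_subspace_kernel[OF lin])
  define K where "K = {z. \<forall>d\<in>N. orthogonal d z}"
  have K: "subspace K"
    unfolding K_def subspace_def by (auto simp: orthogonal_def inner_add_right)
  have cont: "continuous_on A (\<lambda>z. S z \<bullet> z)" for A
    by (intro continuous_intros linear_continuous_on[OF lin[unfolded linear_conv_bounded_linear]])
  obtain \<mu> where \<mu>: "\<mu> > 0" "\<And>z. z \<in> K \<Longrightarrow> norm z = 1 \<Longrightarrow> \<mu> \<le> S z \<bullet> z"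
  proof (cases "sphere 0 1 \<inter> K = {}")
    case True
    \<comment> \<open>The complement contains no unit vector, so any positive constant
      serves.\<close>
    then show ?thesis by (intro that[of 1]) auto
  next
    case False
    have "compact (sphere 0 1 \<inter> K)"
      by (intro compact_Int_closed compact_sphere closed_subspace K)
    from continuous_attains_inf[OF this False cont]
    obtain z0 where z0: "z0 \<in> sphere 0 1 \<inter> K" "\<And>z. z \<in> sphere 0 1 \<inter> K \<Longrightarrow> S z0 \<bullet> z0 \<le> S z \<bullet> z"
      by blast
    \<comment> \<open>A zero minimum would put the unit vector \<open>z0\<close> in the kernel as
      well as in its complement.\<close>
    have "S z0 \<bullet> z0 \<noteq> 0"
    proof
      assume "S z0 \<bullet> z0 = 0"
      then have "z0 \<in> N" using psd_operator_kernel[OF lin sym psd] by (simp add: N_def)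
      then have "orthogonal z0 z0" using z0(1) by (auto simp: K_def)
      then show False using z0(1) by (auto simp: orthogonal_def)
    qed
    then show ?thesis
      using psd[of z0] z0(2) by (intro that[of "S z0 \<bullet> z0"]) auto
  qed
  have bound: "\<mu> * (norm z)\<^sup>2 \<le> S z \<bullet> z" if z: "z \<in> K" for z
  proof (cases "z = 0")
    case False
    have "\<mu> \<le> S (z /\<^sub>R norm z) \<bullet> (z /\<^sub>R norm z)"
      using False z by (intro \<mu>(2) subspace_scale[OF K]) auto
    then have "\<mu> \<le> (S z \<bullet> z) / (norm z)\<^sup>2"
      by (simp add: linear_scale[OF lin] power2_eq_square divide_inverse mult_ac)
    then show ?thesis using False by (simp add: pos_le_divide_eq)
  qed simp
  show ?thesis
  proof (rule that[OF \<mu>(1)])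
    fix v
    obtain d z where dz: "d \<in> span N" "\<And>w. w \<in> span N \<Longrightarrow> orthogonal z w" "v = d + z"
      using orthogonal_subspace_decomp_exists[of N v] by blast
    have dN: "d \<in> N" using dz(1) span_eq_iff[THEN iffD2, OF N] by simp
    have zK: "z \<in> K" unfolding K_def using dz(2) span_base orthogonal_commute by blast
    have "orthogonal d z" using dN zK by (auto simp: K_def)
    then have "(norm v)\<^sup>2 = (norm d)\<^sup>2 + (norm z)\<^sup>2"
      by (simp add: dz(3) norm_add_Pythagorean)
    then have "(norm d)\<^sup>2 \<le> (norm v)\<^sup>2" "(norm z)\<^sup>2 \<le> (norm v)\<^sup>2"
      by simp_all
    then have "norm d \<le> norm v" "norm z \<le> norm v"
      by (simp_all only: power2_le_iff_abs_le norm_ge_zero abs_norm_cancel)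
    then show "\<exists>d z. v = d + z \<and> S d = 0 \<and> norm d \<le> norm v \<and> norm z \<le> norm v \<and>
        \<mu> * (norm z)\<^sup>2 \<le> S z \<bullet> z"
      using dN bound[OF zK] dz(3) unfolding N_def by blast
  qed
qed

text \<open>The unsimplified \<open>1 - (- \<epsilon>)\<close> keeps the shape \<open>(1 - s) x + s y\<close> of affine combinations.\<close>

lemma rel_interior_prolong:
  fixes S :: "'a::euclidean_space set"
  assumes "convex S" "x \<in> S"
  shows "x \<in> rel_interior S \<longleftrightarrow> (\<forall>y\<in>S. \<exists>\<epsilon>>0. (1 - (- \<epsilon>)) *\<^sub>R x + (- \<epsilon>) *\<^sub>R y \<in> S)"
proof -
  have "S \<noteq> {}" using assms(2) by auto
  have "(\<exists>e>1. (1 - e) *\<^sub>R y + e *\<^sub>R x \<in> S) \<longleftrightarrow> (\<exists>\<epsilon>>0. (1 - (- \<epsilon>)) *\<^sub>R x + (- \<epsilon>) *\<^sub>R y \<in> S)" for y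
  proof safe
    fix e :: real assume "e > 1" "(1 - e) *\<^sub>R y + e *\<^sub>R x \<in> S"
    then show "\<exists>\<epsilon>>0. (1 - (- \<epsilon>)) *\<^sub>R x + (- \<epsilon>) *\<^sub>R y \<in> S"
      by (intro exI[of _ "e - 1"]) (simp add: add.commute)
  next
    fix e :: real assume "e > 0" "(1 - (- e)) *\<^sub>R x + (- e) *\<^sub>R y \<in> S"
    then show "\<exists>e>1. (1 - e) *\<^sub>R y + e *\<^sub>R x \<in> S"
      by (intro exI[of _ "1 + e"]) (simp add: add.commute)
  qed
  then show ?thesis
    using convex_rel_interior_iff[OF assms(1) \<open>S \<noteq> {}\<close>] by simp
qed

text \<open>Divide out the lowest surviving power of \<open>s\<close> and let \<open>s\<close> tend
  to 0 from the right; coefficients of odd powers are settled by using both signs of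
  \<open>s\<close>.\<close>

lemma cubic_nonneg_near_0:
  fixes a k l \<epsilon> :: real
  assumes "\<epsilon> > 0" and nonneg: "\<And>s. \<bar>s\<bar> \<le> \<epsilon> \<Longrightarrow> 0 \<le> s * a + s\<^sup>2 * k + s ^ 3 * l"
  shows "a = 0" "0 \<le> k" "k = 0 \<Longrightarrow> l = 0"
proof -
  have lead: "0 \<le> a'" if "\<And>s. 0 < s \<Longrightarrow> s \<le> \<epsilon> \<Longrightarrow> 0 \<le> a' + s * k' + s\<^sup>2 * l'" for a' k' l' :: real
  proof (rule tendsto_lowerbound)
    show "((\<lambda>s. a' + s * k' + s\<^sup>2 * l') \<longlongrightarrow> a') (at_right 0)"
      by (auto intro!: tendsto_eq_intros)
    show "\<forall>\<^sub>F s in at_right 0. 0 \<le> a' + s * k' + s\<^sup>2 * l'"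
      unfolding eventually_at_right_field using that \<open>\<epsilon> > 0\<close> by (intro exI[of _ \<epsilon>]) auto
  qed simp
  have "0 \<le> a"
  proof (rule lead)
    fix s assume s: "0 < s" "s \<le> \<epsilon>"
    have "0 \<le> s * (a + s * k + s\<^sup>2 * l)"
      using nonneg[of s] s by (simp add: algebra_simps power2_eq_square power3_eq_cube)
    then show "0 \<le> a + s * k + s\<^sup>2 * l" using s by (simp add: zero_le_mult_iff)
  qed
  moreover have "0 \<le> - a"
  proof (rule lead)
    fix s assume s: "0 < s" "s \<le> \<epsilon>"
    have "0 \<le> s * (- a + s * k + s\<^sup>2 * (- l))"
      using nonneg[of "- s"] s by (simp add: algebra_simps power2_eq_square power3_eq_cube)
    then show "0 \<le> - a + s * k + s\<^sup>2 * (- l)" using s by (simp add: zero_le_mult_iff)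
  qed
  ultimately show a: "a = 0" by simp
  show "0 \<le> k"
  proof (rule lead)
    fix s assume s: "0 < s" "s \<le> \<epsilon>"
    have "0 \<le> s\<^sup>2 * (k + s * l + s\<^sup>2 * 0)"
      using nonneg[of s] s a by (simp add: algebra_simps power2_eq_square power3_eq_cube)
    then show "0 \<le> k + s * l + s\<^sup>2 * 0" using s by (simp add: zero_le_mult_iff)
  qed
  show "l = 0" if "k = 0"
    using nonneg[of \<epsilon>] nonneg[of "- \<epsilon>"] that a \<open>\<epsilon> > 0\<close>
    by (simp add: zero_le_mult_iff mult_le_0_iff)
qed

section \<open>Cubics in terms of symmetric forms\<close>

text \<open>\<open>q u v \<bullet> w\<close> stands for the third derivative as a trilinear form;
  exchanging the first two and the last two arguments generates all permutations.\<close>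

locale symmetric_forms =
  fixes M :: "'a::euclidean_space \<Rightarrow> 'a" and q :: "'a \<Rightarrow> 'a \<Rightarrow> 'a"
  assumes linear_M: "linear M" and M_sym: "M u \<bullet> v = u \<bullet> M v"
    and bilinear_q: "bilinear q" and q_commute: "q u v = q v u"
    and q_inner_commute: "q u v \<bullet> w = q u w \<bullet> v"
begin

lemmas M_simps = linear_add[OF linear_M] linear_scale[OF linear_M]
lemmas q_simps = bilinear_ladd[OF bilinear_q] bilinear_radd[OF bilinear_q]
  bilinear_lmul[OF bilinear_q] bilinear_rmul[OF bilinear_q]

lemma q_bounded: "bounded_bilinear q"
  using bilinear_q by (simp add: bilinear_conv_bounded_bilinear)

lemma q_bound: "\<exists>B>0. \<forall>u v. \<bar>q u v \<bullet> v\<bar> \<le> B * norm u * (norm v)\<^sup>2"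
proof -
  obtain B where B: "B > 0" "\<And>u v. norm (q u v) \<le> norm u * norm v * B"
    using bounded_bilinear.pos_bounded[OF q_bounded] by blast
  have "\<bar>q u v \<bullet> v\<bar> \<le> B * norm u * (norm v)\<^sup>2" for u v
  proof -
    have "\<bar>q u v \<bullet> v\<bar> \<le> norm (q u v) * norm v" by (rule Cauchy_Schwarz_ineq2)
    also have "\<dots> \<le> (norm u * norm v * B) * norm v" by (intro mult_right_mono B) simp
    finally show ?thesis by (simp add: power2_eq_square mult_ac)
  qed
  with B(1) show ?thesis by blast
qed

end

locale cubic_expansion = symmetric_forms M q for M :: "'a::euclidean_space \<Rightarrow> 'a" and q +
  fixes c :: real and b :: 'a
begin

definition "cub x = c + b \<bullet> x + M x \<bullet> x / 2 + q x x \<bullet> x / 6"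
definition "grad x = b + M x + q x x /\<^sub>R 2"
definition "hess x v = M v + q x v"

definition "psd x \<longleftrightarrow> (\<forall>v. 0 \<le> hess x v \<bullet> v)"

definition "crit = {x. grad x = 0}"
definition "CR = {x. psd x}"
definition "SO = {x \<in> crit. psd x}"
definition "LM = {x. \<exists>\<epsilon>>0. \<forall>y. norm (y - x) \<le> \<epsilon> \<longrightarrow> cub x \<le> cub y}"

section \<open>Exact Taylor expansions and derivatives of the cubic\<close>

lemma linear_hess: "linear (hess x)"
  by (rule linearI) (simp_all add: hess_def M_simps q_simps algebra_simps)

lemma hess_sym: "hess x u \<bullet> v = u \<bullet> hess x v"
  using M_sym[of u v] q_inner_commute[of x u v]
  by (simp add: hess_def inner_add_left inner_add_right inner_commute)

lemmas hess_simps = linear_add[OF linear_hess] linear_scale[OF linear_hess]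

lemma hess_add: "hess (x + w) v = hess x v + q w v"
  by (simp add: hess_def q_simps)

lemma hess_affine: "hess ((1 - s) *\<^sub>R x + s *\<^sub>R y) v = (1 - s) *\<^sub>R hess x v + s *\<^sub>R hess y v"
  by (simp only: hess_def q_simps scaleR_add_right) (simp add: algebra_simps)

lemma hess_eq_0: "psd x \<Longrightarrow> hess x v \<bullet> v = 0 \<Longrightarrow> hess x v = 0"
  by (rule psd_operator_kernel[OF linear_hess hess_sym]) (auto simp: psd_def)

lemma grad_add: "grad (x + w) = grad x + hess x w + q w w /\<^sub>R 2"
  using q_commute[of x w]
  by (simp add: grad_def hess_def M_simps q_simps scaleR_add_right flip: scaleR_2)

text \<open>The third derivative is constant, so Taylor's formula at \<open>x\<close> is exact;
  symmetry of \<open>M\<close> and \<open>q\<close> merges the mixed terms.\<close>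

lemma cub_add: "cub (x + v) = cub x + grad x \<bullet> v + hess x v \<bullet> v / 2 + q v v \<bullet> v / 6"
proof -
  have q1: "q x v \<bullet> x = q x x \<bullet> v" "q v x = q x v" "q v v \<bullet> x = q x v \<bullet> v" "M v \<bullet> x = M x \<bullet> v"
    using q_inner_commute[of x v x] q_commute[of v x] q_inner_commute[of v v x] M_sym[of x v]
    by (auto simp: inner_commute)
  show ?thesis
    by (simp add: cub_def grad_def hess_def M_simps q_simps q1 inner_add_left inner_add_right
        add_divide_distrib)
qed

lemma has_derivative_M: "(M has_derivative M) (at x)"
  using linear_M by (simp add: bounded_linear_imp_has_derivative linear_conv_bounded_linear)

lemma has_derivative_q: "((\<lambda>x. q x x) has_derivative (\<lambda>h. q x h + q h x)) (at x)"
  by (rule bounded_bilinear.FDERIV[OF q_bounded has_derivative_ident has_derivative_ident])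

lemma has_derivative_cub: "(cub has_derivative (\<lambda>h. h \<bullet> grad x)) (at x)"
proof -
  have "((\<lambda>x. c + b \<bullet> x + M x \<bullet> x / 2 + q x x \<bullet> x / 6) has_derivative
      (\<lambda>h. b \<bullet> h + (M x \<bullet> h + M h \<bullet> x) / 2 + (q x x \<bullet> h + (q x h + q h x) \<bullet> x) / 6)) (at x)"
    by (rule has_derivative_eq_rhs,
        (rule has_derivative_M has_derivative_q has_derivative_ident has_derivative_const
          has_derivative_add has_derivative_inner
          bounded_linear.has_derivative[OF bounded_linear_divide])+)
      (simp add: fun_eq_iff add_divide_distrib)
  moreover have "b \<bullet> h + (M x \<bullet> h + M h \<bullet> x) / 2 + (q x x \<bullet> h + (q x h + q h x) \<bullet> x) / 6 = h \<bullet> grad x"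
    for h
  proof -
    \<comment> \<open>By symmetry the three terms of the derivative of the cubic part coincide,
      which turns 1/6 into the 1/2 of \<open>grad\<close>.\<close>
    have q1: "q x h \<bullet> x = q x x \<bullet> h" "q h x = q x h" "M h \<bullet> x = M x \<bullet> h"
      using q_inner_commute[of x h x] q_commute[of h x] M_sym[of h x] by (auto simp: inner_commute)
    show ?thesis
      by (simp add: q1 inner_add_left inner_commute[of h "grad x"]) (simp add: grad_def inner_add_left)
  qed
  ultimately show ?thesis
    unfolding cub_def[abs_def] by simp
qed

lemma has_derivative_grad: "(grad has_derivative hess x) (at x)"
  unfolding grad_def[abs_def]
  by (rule has_derivative_eq_rhs,
      (rule has_derivative_M has_derivative_q has_derivative_const has_derivative_add
        has_derivative_scaleR_right)+)
    (simp add: fun_eq_iff hess_def q_commute[of _ x] flip: scaleR_2)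

section \<open>Local minima and second-order points\<close>

lemma local_min_necessary:
  assumes "x \<in> LM"
  shows "x \<in> SO" "\<And>d. hess x d = 0 \<Longrightarrow> q d d = 0"
proof -
  obtain \<epsilon> where \<epsilon>: "\<epsilon> > 0" "\<And>y. norm (y - x) \<le> \<epsilon> \<Longrightarrow> cub x \<le> cub y"
    using assms unfolding LM_def by blast
  have line: "0 \<le> s * (grad y \<bullet> v) + s\<^sup>2 * (hess y v \<bullet> v / 2) + s ^ 3 * (q v v \<bullet> v / 6)"
    if "cub y \<le> cub (y + s *\<^sub>R v)" for y s v
    using that by (simp add: cub_add hess_simps q_simps power2_eq_square power3_eq_cube mult_ac)
  \<comment> \<open>The base point \<open>y\<close> is kept general because the test is applied at
    \<open>x\<close> and again at the shifted point \<open>x + s *\<^sub>R d\<close>.\<close>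
  have first: "grad y \<bullet> v = 0 \<and> 0 \<le> hess y v \<bullet> v / 2 \<and> (hess y v \<bullet> v / 2 = 0 \<longrightarrow> q v v \<bullet> v / 6 = 0)"
    if "\<delta> > 0" and min: "\<And>s. norm (s *\<^sub>R v) \<le> \<delta> \<Longrightarrow> cub y \<le> cub (y + s *\<^sub>R v)" for y v \<delta>
  proof -
    have pos: "0 < \<delta> / (norm v + 1)"
      using \<open>\<delta> > 0\<close> by (simp add: add_nonneg_pos)
    have "0 \<le> s * (grad y \<bullet> v) + s\<^sup>2 * (hess y v \<bullet> v / 2) + s ^ 3 * (q v v \<bullet> v / 6)"
      if s: "\<bar>s\<bar> \<le> \<delta> / (norm v + 1)" for s
    proof (intro line min)
      have "norm (s *\<^sub>R v) \<le> \<bar>s\<bar> * (norm v + 1)" by (simp add: mult_left_mono)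
      also have "\<dots> \<le> \<delta>" using s by (simp add: pos_le_divide_eq add_nonneg_pos)
      finally show "norm (s *\<^sub>R v) \<le> \<delta>" .
    qed
    from cubic_nonneg_near_0[OF pos this] show ?thesis by blast
  qed
  have at_x: "grad x \<bullet> v = 0 \<and> 0 \<le> hess x v \<bullet> v / 2 \<and>
      (hess x v \<bullet> v / 2 = 0 \<longrightarrow> q v v \<bullet> v / 6 = 0)" for v
    by (rule first[OF \<epsilon>(1)]) (auto intro: \<epsilon>(2))
  have "grad x \<bullet> grad x = 0" using at_x by blast
  then have grad0: "grad x = 0" by simp
  with at_x show "x \<in> SO" by (auto simp: SO_def crit_def psd_def)
  fix d assume d: "hess x d = 0"
  \<comment> \<open>A shift of norm at most \<open>\<epsilon> / 2\<close> keeps the ball of radius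
    \<open>\<epsilon> / 2\<close> around the new point inside the original ball; the added 1 covers
    \<open>d = 0\<close>.\<close>
  define s where "s = \<epsilon> / 2 / (norm d + 1)"
  have nd: "0 < norm d + 1" by (simp add: add_nonneg_pos)
  then have s: "s > 0" using \<epsilon>(1) by (simp add: s_def)
  have "s * norm d \<le> s * (norm d + 1)" using s by (intro mult_left_mono) auto
  also have "\<dots> = \<epsilon> / 2" using nd unfolding s_def by (intro nonzero_eq_divide_eq[THEN iffD1]) auto
  finally have sd: "norm (s *\<^sub>R d) \<le> \<epsilon> / 2" using s by simp
  have "q d d \<bullet> d = 0" using at_x[of d] d by simp
  then have flat: "cub (x + s *\<^sub>R d) = cub x"
    by (simp add: cub_add grad0 d hess_simps q_simps)
  \<comment> \<open>The shifted point has the same value as \<open>x\<close>, so it is itself a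
    local minimum.\<close>
  have "grad (x + s *\<^sub>R d) \<bullet> v = 0" for v
  proof -
    have "cub (x + s *\<^sub>R d) \<le> cub (x + s *\<^sub>R d + r *\<^sub>R v)" if "norm (r *\<^sub>R v) \<le> \<epsilon> / 2" for r
      unfolding flat using norm_triangle_le[of "s *\<^sub>R d" "r *\<^sub>R v" \<epsilon>] sd that
      by (intro \<epsilon>(2)) (simp add: add.assoc)
    with first[of "\<epsilon> / 2"] \<epsilon>(1) show ?thesis by simp
  qed
  then have "grad (x + s *\<^sub>R d) = 0"
    using inner_eq_zero_iff by blast
  then show "q d d = 0"
    using s by (simp add: grad_add grad0 d hess_simps q_simps)
qed

lemma local_min_sufficient:
  assumes x: "x \<in> SO" and ker: "\<And>d. hess x d = 0 \<Longrightarrow> q d d = 0"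
  shows "x \<in> LM"
proof -
  have grad0: "grad x = 0" and psd: "\<And>v. 0 \<le> hess x v \<bullet> v"
    using x by (auto simp: SO_def crit_def psd_def)
  obtain \<mu> where \<mu>: "\<mu> > 0" and split: "\<And>v. \<exists>d z. v = d + z \<and> hess x d = 0 \<and>
      norm d \<le> norm v \<and> norm z \<le> norm v \<and> \<mu> * (norm z)\<^sup>2 \<le> hess x z \<bullet> z"
    using psd_operator_coercive[OF linear_hess hess_sym psd] by blast
  obtain B where B: "B > 0" "\<And>u v. \<bar>q u v \<bullet> v\<bar> \<le> B * norm u * (norm v)\<^sup>2"
    using q_bound by blast
  \<comment> \<open>With this radius the two cubic error terms cost at most \<open>\<mu> / 4\<close>
    and \<open>\<mu> / 12\<close> times the squared norm of \<open>z\<close>, while the Hessian term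
    supplies at least \<open>\<mu> / 2\<close> times it.\<close>
  have "cub x \<le> cub y" if y: "norm (y - x) \<le> \<mu> / (2 * B)" for y
  proof -
    obtain d z where dz: "y - x = d + z" "hess x d = 0" "norm d \<le> norm (y - x)"
        "norm z \<le> norm (y - x)" "\<mu> * (norm z)\<^sup>2 \<le> hess x z \<bullet> z"
      using split by blast
    have qd: "q d d = 0" using ker dz(2) by blast
    have small: "\<bar>q u z \<bullet> z\<bar> \<le> \<mu> / 2 * (norm z)\<^sup>2" if "norm u \<le> norm (y - x)" for u
    proof -
      have "B * norm u \<le> B * (\<mu> / (2 * B))" using that y B(1) by (intro mult_left_mono) auto
      also have "\<dots> = \<mu> / 2" using B(1) by simp
      finally have "B * norm u * (norm z)\<^sup>2 \<le> \<mu> / 2 * (norm z)\<^sup>2" by (rule mult_right_mono) simp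
      with B(2)[of u z] show ?thesis by linarith
    qed
    \<comment> \<open>Total symmetry and \<open>q d d = 0\<close> remove every cubic term containing
      \<open>d\<close> more than once.\<close>
    have 1: "q z d = q d z" "q d z \<bullet> d = 0" "q z z \<bullet> d = q d z \<bullet> z"
      using q_commute[of z d] q_inner_commute[of d z d] q_inner_commute[of z z d] qd by auto
    have H: "hess x z \<bullet> d = 0" using hess_sym[of x z d] dz(2) by simp
    have "cub y = cub (x + (d + z))" by (simp flip: dz(1))
    also have "\<dots> = cub x + hess x z \<bullet> z / 2 + q d z \<bullet> z / 2 + q z z \<bullet> z / 6"
      by (simp add: cub_add grad0 hess_simps q_simps dz(2) qd 1 H inner_add_left inner_add_right)
    finally show ?thesis
      using small[OF dz(3)] small[OF dz(4)] dz(5) mult_nonneg_nonneg[of \<mu> "(norm z)\<^sup>2"] \<mu> by simp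
  qed
  then show ?thesis
    using \<mu> B(1) unfolding LM_def by (intro CollectI exI[of _ "\<mu> / (2 * B)"]) auto
qed

text \<open>With \<open>w = y - x\<close>, pairing \<open>grad y = 0\<close> with \<open>w\<close>
  says that the average of \<open>hess x w \<bullet> w\<close> and
  \<open>hess y w \<bullet> w\<close> is zero. Both are nonnegative, so \<open>hess x w = 0\<close>,
  hence \<open>q w w = 0\<close>, and the gradient vanishes on the whole line.\<close>

lemma grad_line_second_order:
  assumes "x \<in> SO" "y \<in> SO"
  shows "grad ((1 - s) *\<^sub>R x + s *\<^sub>R y) = 0"
proof -
  define w where "w = y - x"
  have y: "y = x + w" by (simp add: w_def)
  have g: "grad x = 0" "grad y = 0" and psd: "psd x" "psd y"
    using assms by (auto simp: SO_def crit_def)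
  have e: "hess x w + q w w /\<^sub>R 2 = 0" using g by (simp add: y grad_add)
  then have "(hess x w + q w w /\<^sub>R 2) \<bullet> w = 0" by simp
  then have "hess x w \<bullet> w + q w w \<bullet> w / 2 = 0" by (simp add: inner_add_left)
  moreover have "0 \<le> hess x w \<bullet> w" "0 \<le> hess x w \<bullet> w + q w w \<bullet> w"
    using psd unfolding psd_def y hess_add inner_add_left by auto
  ultimately have "hess x w \<bullet> w = 0" by linarith
  then have H: "hess x w = 0" by (rule hess_eq_0[OF psd(1)])
  have "(1 - s) *\<^sub>R x + s *\<^sub>R y = x + s *\<^sub>R w" by (simp add: y algebra_simps)
  then show ?thesis using g e H by (simp add: grad_add hess_simps q_simps)
qed

section \<open>Convexity of the two regions\<close>

lemma psd_affine:
  assumes "psd x" "psd y" "0 \<le> s" "s \<le> 1"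
  shows "psd ((1 - s) *\<^sub>R x + s *\<^sub>R y)"
  using assms unfolding psd_def hess_affine by (simp add: inner_add_left)

lemma convex_CR: "convex CR"
  unfolding convex_alt CR_def using psd_affine by auto

lemma convex_SO: "convex SO"
  unfolding convex_alt
proof (intro ballI allI impI)
  fix x y s assume "x \<in> SO" "y \<in> SO" "0 \<le> (s::real) \<and> s \<le> 1"
  then show "(1 - s) *\<^sub>R x + s *\<^sub>R y \<in> SO"
    using grad_line_second_order[of x y s] psd_affine[of x y s] by (simp add: SO_def crit_def)
qed

section \<open>Inclusions between the three sets\<close>

lemma local_min_in_rel_interior_CR:
  assumes "x \<in> LM"
  shows "x \<in> rel_interior CR"
proof -
  have x: "x \<in> SO" and ker: "\<And>d. hess x d = 0 \<Longrightarrow> q d d = 0"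
    using local_min_necessary[OF assms] by auto
  have psd: "\<And>v. 0 \<le> hess x v \<bullet> v" and xCR: "x \<in> CR"
    using x by (auto simp: SO_def psd_def CR_def)
  obtain \<mu> where \<mu>: "\<mu> > 0" and split: "\<And>v. \<exists>d z. v = d + z \<and> hess x d = 0 \<and>
      norm d \<le> norm v \<and> norm z \<le> norm v \<and> \<mu> * (norm z)\<^sup>2 \<le> hess x z \<bullet> z"
    using psd_operator_coercive[OF linear_hess hess_sym psd] by blast
  obtain B where B: "B > 0" "\<And>u v. \<bar>q u v \<bullet> v\<bar> \<le> B * norm u * (norm v)\<^sup>2"
    using q_bound by blast
  show ?thesis
    unfolding rel_interior_prolong[OF convex_CR xCR]
  proof
    fix y assume "y \<in> CR"
    define w where "w = y - x"
    \<comment> \<open>Chosen so that \<open>\<epsilon> * \<bar>q w z \<bullet> z\<bar>\<close> is at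
      most \<open>\<mu>\<close> times the squared norm of \<open>z\<close>; the added 1 covers
      \<open>w = 0\<close>.\<close>
    define \<epsilon> where "\<epsilon> = \<mu> / (B * (norm w + 1))"
    have nw: "0 < norm w + 1" by (simp add: add_nonneg_pos)
    then have \<epsilon>: "\<epsilon> > 0" using \<mu> B by (simp add: \<epsilon>_def)
    \<comment> \<open>On the kernel of \<open>hess x\<close> the form of \<open>hess y\<close> is
      \<open>q w d \<bullet> d = q d d \<bullet> w = 0\<close>, so semidefiniteness at
      \<open>y\<close> forces \<open>hess y d = 0\<close>. Moving along \<open>w\<close> thus leaves
      this kernel annihilated.\<close>
    have qw: "q w d = 0" if d: "hess x d = 0" for d
    proof -
      have "hess y d = q w d" using d hess_add[of x w d] by (simp add: w_def)
      moreover have "q w d \<bullet> d = 0"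
        using q_commute[of w d] q_inner_commute[of d w d] ker[OF d] by simp
      ultimately show ?thesis
        using hess_eq_0[of y d] \<open>y \<in> CR\<close> by (simp add: CR_def)
    qed
    have "0 \<le> hess (x + (- \<epsilon>) *\<^sub>R w) v \<bullet> v" for v
    proof -
      obtain d z where dz: "v = d + z" "hess x d = 0" "\<mu> * (norm z)\<^sup>2 \<le> hess x z \<bullet> z"
        using split by blast
      have d0: "hess (x + (- \<epsilon>) *\<^sub>R w) d = 0" by (simp only: hess_add q_simps dz(2) qw) simp
      have "\<epsilon> * \<bar>q w z \<bullet> z\<bar> \<le> \<epsilon> * (B * (norm w + 1) * (norm z)\<^sup>2)"
      proof (intro mult_left_mono order_trans[OF B(2)])
        show "B * norm w * (norm z)\<^sup>2 \<le> B * (norm w + 1) * (norm z)\<^sup>2"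
          using B(1) by (intro mult_right_mono mult_left_mono) auto
      qed (use \<epsilon> in simp)
      also have "\<dots> = \<mu> * (norm z)\<^sup>2" using B(1) nw by (simp add: \<epsilon>_def)
      also have "\<dots> \<le> hess x z \<bullet> z" by (rule dz(3))
      finally have "\<epsilon> * (q w z \<bullet> z) \<le> hess x z \<bullet> z"
        using \<epsilon> mult_left_mono[of "q w z \<bullet> z" "\<bar>q w z \<bullet> z\<bar>" \<epsilon>] by linarith
      then have "0 \<le> hess (x + (- \<epsilon>) *\<^sub>R w) z \<bullet> z"
        by (simp only: hess_add q_simps inner_add_left inner_scaleR_left)
      \<comment> \<open>The perturbed Hessian is self-adjoint and kills \<open>d\<close>, so the
        cross terms vanish.\<close>
      also have "\<dots> = hess (x + (- \<epsilon>) *\<^sub>R w) v \<bullet> v"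
        using hess_sym[of "x + (- \<epsilon>) *\<^sub>R w" z d]
        by (simp only: dz(1) hess_simps d0 inner_add_right inner_zero_right) simp
      finally show ?thesis .
    qed
    then have "x + (- \<epsilon>) *\<^sub>R w \<in> CR" by (simp only: CR_def psd_def mem_Collect_eq) simp
    moreover have "x + (- \<epsilon>) *\<^sub>R w = (1 - (- \<epsilon>)) *\<^sub>R x + (- \<epsilon>) *\<^sub>R y"
      by (simp add: w_def algebra_simps)
    ultimately show "\<exists>\<epsilon>>0. (1 - (- \<epsilon>)) *\<^sub>R x + (- \<epsilon>) *\<^sub>R y \<in> CR"
      using \<epsilon> by auto
  qed
qed

lemma critical_rel_interior_CR_subset: "crit \<inter> rel_interior CR \<subseteq> rel_interior SO"
proof
  fix x assume x: "x \<in> crit \<inter> rel_interior CR"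
  then have xCR: "x \<in> CR" using rel_interior_subset by blast
  then have xSO: "x \<in> SO" using x by (simp add: SO_def CR_def)
  show "x \<in> rel_interior SO"
    unfolding rel_interior_prolong[OF convex_SO xSO]
  proof
    fix y assume y: "y \<in> SO"
    then have "y \<in> CR" by (simp add: SO_def CR_def)
    then obtain \<epsilon> where \<epsilon>: "\<epsilon> > 0" "(1 - (- \<epsilon>)) *\<^sub>R x + (- \<epsilon>) *\<^sub>R y \<in> CR"
      using x rel_interior_prolong[OF convex_CR xCR] by blast
    \<comment> \<open>The gradient vanishes for every real parameter on the line, so the negative
      one, outside the segment, is allowed.\<close>
    have "(1 - (- \<epsilon>)) *\<^sub>R x + (- \<epsilon>) *\<^sub>R y \<in> SO"
      using \<epsilon>(2) grad_line_second_order[OF xSO y, of "- \<epsilon>"] by (simp add: SO_def CR_def crit_def)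
    with \<epsilon>(1) show "\<exists>\<epsilon>>0. (1 - (- \<epsilon>)) *\<^sub>R x + (- \<epsilon>) *\<^sub>R y \<in> SO" by blast
  qed
qed

lemma rel_interior_SO_subset_LM:
  assumes "x\<^sub>0 \<in> LM"
  shows "rel_interior SO \<subseteq> LM"
proof
  fix x assume x: "x \<in> rel_interior SO"
  then have xSO: "x \<in> SO" using rel_interior_subset by blast
  have x0: "x\<^sub>0 \<in> SO" and ker: "\<And>d. hess x\<^sub>0 d = 0 \<Longrightarrow> q d d = 0"
    using local_min_necessary[OF assms] by auto
  obtain \<epsilon> where \<epsilon>: "\<epsilon> > 0" and z: "(1 - (- \<epsilon>)) *\<^sub>R x + (- \<epsilon>) *\<^sub>R x\<^sub>0 \<in> SO"
    using x x0 rel_interior_prolong[OF convex_SO xSO] by blast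
  have psd: "psd x\<^sub>0" using x0 by (simp add: SO_def)
  show "x \<in> LM"
  proof (rule local_min_sufficient[OF xSO])
    fix d assume d: "hess x d = 0"
    \<comment> \<open>The Hessian at the prolonged point is \<open>(1 + \<epsilon>)\<close> times
      that at \<open>x\<close> minus \<open>\<epsilon>\<close> times that at
      \<open>x\<^sub>0\<close>; on \<open>d\<close> only the latter survives.\<close>
    have "0 \<le> hess ((1 - (- \<epsilon>)) *\<^sub>R x + (- \<epsilon>) *\<^sub>R x\<^sub>0) d \<bullet> d"
      using z by (simp only: SO_def psd_def mem_Collect_eq)
    then have "hess x\<^sub>0 d \<bullet> d \<le> 0"
      unfolding hess_affine using d \<epsilon> by (simp add: mult_le_0_iff)
    then have "hess x\<^sub>0 d \<bullet> d = 0" using psd by (simp add: psd_def antisym)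
    then show "q d d = 0" using hess_eq_0[OF psd] ker by blast
  qed
qed

text \<open>The inclusions close a cycle through the three sets; nonemptiness supplies the reference
  minimum \<open>x\<^sub>0\<close>.\<close>

theorem local_minima_rel_interior:
  assumes "LM \<noteq> {}"
  shows "LM = rel_interior SO" "rel_interior SO = crit \<inter> rel_interior CR"
proof -
  have "LM \<subseteq> crit \<inter> rel_interior CR"
    using local_min_in_rel_interior_CR local_min_necessary(1) by (auto simp: SO_def)
  moreover have "rel_interior SO \<subseteq> LM"
    using assms rel_interior_SO_subset_LM by blast
  ultimately show "LM = rel_interior SO" "rel_interior SO = crit \<inter> rel_interior CR"
    using critical_rel_interior_CR_subset by auto
qed

end

section \<open>Polynomials of degree at most three\<close>

text \<open>This property is closed under sums, so a polynomial can be treated monomial by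
  monomial.\<close>

definition has_symmetric_forms :: "('a::euclidean_space \<Rightarrow> real) \<Rightarrow> bool"
  where "has_symmetric_forms p \<longleftrightarrow> (\<exists>M q c b. symmetric_forms M q \<and>
    (\<forall>x. p x = c + b \<bullet> x + M x \<bullet> x / 2 + q x x \<bullet> x / 6))"

lemma has_symmetric_forms_add:
  assumes "has_symmetric_forms p" "has_symmetric_forms p'"
  shows "has_symmetric_forms (\<lambda>x. p x + p' x)"
proof -
  obtain M q c b where 1: "symmetric_forms M q"
    "\<And>x. p x = c + b \<bullet> x + M x \<bullet> x / 2 + q x x \<bullet> x / 6"
    using assms(1) unfolding has_symmetric_forms_def by blast
  obtain M' q' c' b' where 2: "symmetric_forms M' q'"
    "\<And>x. p' x = c' + b' \<bullet> x + M' x \<bullet> x / 2 + q' x x \<bullet> x / 6"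
    using assms(2) unfolding has_symmetric_forms_def by blast
  interpret A: symmetric_forms M q by fact
  interpret B: symmetric_forms M' q' by fact
  have "symmetric_forms (\<lambda>x. M x + M' x) (\<lambda>x y. q x y + q' x y)"
  proof (rule symmetric_forms.intro)
    show "linear (\<lambda>x. M x + M' x)"
      by (rule linear_compose_add[OF A.linear_M B.linear_M])
    show "bilinear (\<lambda>x y. q x y + q' x y)"
      using A.bilinear_q B.bilinear_q by (auto simp: bilinear_def intro: linear_compose_add)
    show "(M u + M' u) \<bullet> v = u \<bullet> (M v + M' v)" for u v
      by (simp add: inner_add_left inner_add_right A.M_sym B.M_sym)
    show "q u v + q' u v = q v u + q' v u" for u v
      using A.q_commute[of u v] B.q_commute[of u v] by simp
    show "(q u v + q' u v) \<bullet> w = (q u w + q' u w) \<bullet> v" for u v w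
      using A.q_inner_commute[of u v w] B.q_inner_commute[of u v w] by (simp add: inner_add_left)
  qed
  moreover have "p x + p' x = (c + c') + (b + b') \<bullet> x + (M x + M' x) \<bullet> x / 2 +
      (q x x + q' x x) \<bullet> x / 6" for x
    by (simp add: 1 2 inner_add_left add_divide_distrib)
  ultimately show ?thesis
    unfolding has_symmetric_forms_def
    by (intro exI[of _ "\<lambda>x. M x + M' x"] exI[of _ "\<lambda>x y. q x y + q' x y"]
        exI[of _ "c + c'"] exI[of _ "b + b'"]) auto
qed

lemma symmetric_forms_zero: "symmetric_forms (\<lambda>_. 0) (\<lambda>_ _. 0)"
  by standard (auto simp: bilinear_def linear_zero)

text \<open>Polarisation of a product of two linear forms: half the form of this operator is
  \<open>(a \<bullet> u) * (b \<bullet> u)\<close>.\<close>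

lemma symmetric_forms_quadratic:
  "symmetric_forms (\<lambda>u. (a \<bullet> u) *\<^sub>R b + (b \<bullet> u) *\<^sub>R a) (\<lambda>_ _. 0)"
  by standard (auto simp: bilinear_def linear_zero inner_add_left inner_add_right algebra_simps
      inner_commute intro!: linearI)

text \<open>The product of three linear forms summed over all six permutations; on the diagonal this
  gives 6 times the product, cancelling the divisor 6.\<close>

lemma symmetric_forms_cubic:
  "symmetric_forms (\<lambda>_. 0) (\<lambda>u v.
    ((a \<bullet> u) * (b \<bullet> v) + (b \<bullet> u) * (a \<bullet> v)) *\<^sub>R c +
    ((a \<bullet> u) * (c \<bullet> v) + (c \<bullet> u) * (a \<bullet> v)) *\<^sub>R b +
    ((b \<bullet> u) * (c \<bullet> v) + (c \<bullet> u) * (b \<bullet> v)) *\<^sub>R a)"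
  by standard (auto simp: bilinear_def linear_zero inner_add_left inner_add_right algebra_simps
      intro!: linearI)

lemma has_symmetric_forms_const: "has_symmetric_forms (\<lambda>_. k)"
  unfolding has_symmetric_forms_def
  by (intro exI[of _ "\<lambda>_. 0"] exI[of _ "\<lambda>_ _. 0"] exI[of _ k] exI[of _ 0])
    (simp add: symmetric_forms_zero)

lemma has_symmetric_forms_linear: "has_symmetric_forms (\<lambda>x. a \<bullet> x)"
  unfolding has_symmetric_forms_def
  by (intro exI[of _ "\<lambda>_. 0"] exI[of _ "\<lambda>_ _. 0"] exI[of _ 0] exI[of _ a])
    (simp add: symmetric_forms_zero)

lemma has_symmetric_forms_quadratic: "has_symmetric_forms (\<lambda>x. (a \<bullet> x) * (b \<bullet> x))"
  unfolding has_symmetric_forms_def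
  by (rule exI, rule exI, rule exI[of _ 0], rule exI[of _ 0],
      rule conjI[OF symmetric_forms_quadratic[of a b]]) (simp add: inner_add_left)

lemma has_symmetric_forms_cubic: "has_symmetric_forms (\<lambda>x. (a \<bullet> x) * ((b \<bullet> x) * (c \<bullet> x)))"
  unfolding has_symmetric_forms_def
  by (rule exI, rule exI, rule exI[of _ 0], rule exI[of _ 0],
      rule conjI[OF symmetric_forms_cubic[of a b c]]) (simp add: inner_add_left algebra_simps)

text \<open>Lowering one nonzero exponent splits off a coordinate, written as an inner product so
  that repetition yields products of linear forms.\<close>

lemma monomial_split:
  fixes m :: "'n::finite \<Rightarrow> nat"
  assumes "(\<Sum>i\<in>UNIV. m i) = Suc d"
  obtains i m' where "(\<Sum>i\<in>UNIV. m' i) = d"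
    "\<And>x :: real ^ 'n. (\<Prod>i\<in>UNIV. (x $ i) ^ m i) = (axis i 1 \<bullet> x) * (\<Prod>i\<in>UNIV. (x $ i) ^ m' i)"
proof -
  have "\<exists>i. m i \<noteq> 0"
  proof (rule ccontr)
    assume "\<not> ?thesis"
    then show False using assms by simp
  qed
  then obtain i where i: "m i \<noteq> 0" by blast
  define m' where "m' = m(i := m i - 1)"
  have "(\<Sum>j\<in>UNIV. m j) = m i + (\<Sum>j\<in>UNIV - {i}. m j)"
    by (simp add: sum.remove)
  moreover have "(\<Sum>j\<in>UNIV. m' j) = m' i + (\<Sum>j\<in>UNIV - {i}. m' j)"
    by (simp add: sum.remove)
  moreover have "(\<Sum>j\<in>UNIV - {i}. m' j) = (\<Sum>j\<in>UNIV - {i}. m j)"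
    by (rule sum.cong) (auto simp: m'_def)
  ultimately have "(\<Sum>j\<in>UNIV. m' j) = d" using assms i by (simp add: m'_def)
  moreover have "(\<Prod>j\<in>UNIV. (x $ j) ^ m j) = (axis i 1 \<bullet> x) * (\<Prod>j\<in>UNIV. (x $ j) ^ m' j)"
    for x :: "real ^ 'n"
  proof -
    have "(\<Prod>j\<in>UNIV. (x $ j) ^ m j) = (x $ i) ^ m i * (\<Prod>j\<in>UNIV - {i}. (x $ j) ^ m j)"
      by (simp add: prod.remove)
    also have "(x $ i) ^ m i = (axis i 1 \<bullet> x) * (x $ i) ^ m' i"
      using i by (cases "m i") (auto simp: m'_def inner_axis inner_axis')
    also have "(\<Prod>j\<in>UNIV - {i}. (x $ j) ^ m j) = (\<Prod>j\<in>UNIV - {i}. (x $ j) ^ m' j)"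
      by (rule prod.cong) (auto simp: m'_def)
    also have "(axis i 1 \<bullet> x) * (x $ i) ^ m' i * \<dots> = (axis i 1 \<bullet> x) * (\<Prod>j\<in>UNIV. (x $ j) ^ m' j)"
      by (simp add: prod.remove[of UNIV i] mult.assoc)
    finally show ?thesis .
  qed
  ultimately show ?thesis by (rule that)
qed

lemma has_symmetric_forms_monomial:
  fixes m :: "'n::finite \<Rightarrow> nat"
  assumes "m \<in> monomials_le 3"
  shows "has_symmetric_forms (\<lambda>x :: real ^ 'n. k * (\<Prod>i\<in>UNIV. (x $ i) ^ m i))"
proof -
  have deg0: "(\<Prod>i\<in>UNIV. (x $ i) ^ m i) = 1" if "(\<Sum>i\<in>UNIV. m i) = 0"
    for m :: "'n \<Rightarrow> nat" and x :: "real ^ 'n"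
    using that by simp
  consider "(\<Sum>i\<in>UNIV. m i) = 0" | "(\<Sum>i\<in>UNIV. m i) = Suc 0" | "(\<Sum>i\<in>UNIV. m i) = Suc (Suc 0)"
    | "(\<Sum>i\<in>UNIV. m i) = Suc (Suc (Suc 0))"
    using assms by (fastforce simp: monomials_le_def)
  then show ?thesis
  proof cases
    case 1
    have "(\<lambda>x :: real ^ 'n. k * (\<Prod>i\<in>UNIV. (x $ i) ^ m i)) = (\<lambda>_. k)"
      using deg0[OF 1] by (simp add: fun_eq_iff)
    then show ?thesis by (simp only: has_symmetric_forms_const)
  next
    case 2
    obtain i m1 where m1: "(\<Sum>i\<in>UNIV. m1 i) = 0"
      "\<And>x. (\<Prod>i\<in>UNIV. (x $ i) ^ m i) = (axis i 1 \<bullet> x) * (\<Prod>i\<in>UNIV. (x $ i) ^ m1 i)"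
      using monomial_split[OF 2] by metis
    \<comment> \<open>The coefficient \<open>k\<close> is absorbed into the first linear form, here
      and in the higher degrees.\<close>
    have "(\<lambda>x :: real ^ 'n. k * (\<Prod>i\<in>UNIV. (x $ i) ^ m i)) = (\<lambda>x. (k *\<^sub>R axis i 1) \<bullet> x)"
      unfolding m1(2) deg0[OF m1(1)] by (simp add: fun_eq_iff)
    then show ?thesis by (simp only: has_symmetric_forms_linear)
  next
    case 3
    obtain i m1 where m1: "(\<Sum>i\<in>UNIV. m1 i) = Suc 0"
      "\<And>x. (\<Prod>i\<in>UNIV. (x $ i) ^ m i) = (axis i 1 \<bullet> x) * (\<Prod>i\<in>UNIV. (x $ i) ^ m1 i)"
      using monomial_split[OF 3] by metis
    obtain j m2 where m2: "(\<Sum>i\<in>UNIV. m2 i) = 0"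
      "\<And>x. (\<Prod>i\<in>UNIV. (x $ i) ^ m1 i) = (axis j 1 \<bullet> x) * (\<Prod>i\<in>UNIV. (x $ i) ^ m2 i)"
      using monomial_split[OF m1(1)] by metis
    have "(\<lambda>x :: real ^ 'n. k * (\<Prod>i\<in>UNIV. (x $ i) ^ m i)) =
        (\<lambda>x. ((k *\<^sub>R axis i 1) \<bullet> x) * (axis j 1 \<bullet> x))"
      unfolding m1(2) m2(2) deg0[OF m2(1)] by (simp add: fun_eq_iff)
    then show ?thesis by (simp only: has_symmetric_forms_quadratic)
  next
    case 4
    obtain i m1 where m1: "(\<Sum>i\<in>UNIV. m1 i) = Suc (Suc 0)"
      "\<And>x. (\<Prod>i\<in>UNIV. (x $ i) ^ m i) = (axis i 1 \<bullet> x) * (\<Prod>i\<in>UNIV. (x $ i) ^ m1 i)"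
      using monomial_split[OF 4] by metis
    obtain j m2 where m2: "(\<Sum>i\<in>UNIV. m2 i) = Suc 0"
      "\<And>x. (\<Prod>i\<in>UNIV. (x $ i) ^ m1 i) = (axis j 1 \<bullet> x) * (\<Prod>i\<in>UNIV. (x $ i) ^ m2 i)"
      using monomial_split[OF m1(1)] by metis
    obtain l m3 where m3: "(\<Sum>i\<in>UNIV. m3 i) = 0"
      "\<And>x. (\<Prod>i\<in>UNIV. (x $ i) ^ m2 i) = (axis l 1 \<bullet> x) * (\<Prod>i\<in>UNIV. (x $ i) ^ m3 i)"
      using monomial_split[OF m2(1)] by metis
    have "(\<lambda>x :: real ^ 'n. k * (\<Prod>i\<in>UNIV. (x $ i) ^ m i)) =
        (\<lambda>x. ((k *\<^sub>R axis i 1) \<bullet> x) * ((axis j 1 \<bullet> x) * (axis l 1 \<bullet> x)))"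
      unfolding m1(2) m2(2) m3(2) deg0[OF m3(1)] by (simp add: fun_eq_iff)
    then show ?thesis by (simp only: has_symmetric_forms_cubic)
  qed
qed

lemma has_symmetric_forms_sum:
  assumes "finite F" "\<And>m. m \<in> F \<Longrightarrow> has_symmetric_forms (f m)"
  shows "has_symmetric_forms (\<lambda>x. \<Sum>m\<in>F. f m x)"
  using assms
  by (induction F rule: finite_induct) (auto intro: has_symmetric_forms_const has_symmetric_forms_add)

lemma cubic_polynomial_has_symmetric_forms:
  assumes "cubic_polynomial p"
  shows "has_symmetric_forms p"
proof -
  obtain c where "\<And>x. p x = (\<Sum>m\<in>monomials_le 3. c m * (\<Prod>i\<in>UNIV. (x $ i) ^ m i))"
    using assms unfolding cubic_polynomial_def by blast
  then have "p = (\<lambda>x. \<Sum>m\<in>monomials_le 3. c m * (\<Prod>i\<in>UNIV. (x $ i) ^ m i))" by blast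
  then show ?thesis
    by (simp only: has_symmetric_forms_sum[OF finite_monomials_le has_symmetric_forms_monomial])
qed

section \<open>Transfer to gradients and Hessian matrices\<close>

theorem theorem4p10:
  fixes p :: "real ^ 'n \<Rightarrow> real"
  assumes "cubic_polynomial p"
    and "local_minima p \<noteq> {}"
  shows "local_minima p = rel_interior (second_order_points p) \<and>
    rel_interior (second_order_points p) = critical_points p \<inter> rel_interior (convexity_region p)"
proof -
  obtain M q c b where sf: "symmetric_forms M q"
    and p: "\<And>x. p x = c + b \<bullet> x + M x \<bullet> x / 2 + q x x \<bullet> x / 6"
    using cubic_polynomial_has_symmetric_forms[OF assms(1)] unfolding has_symmetric_forms_def by blast
  interpret cubic_expansion M q c b using sf by (simp add: cubic_expansion_def)
  have p_eq: "p = cub" by (simp add: fun_eq_iff p cub_def)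
  have "gradient p x = grad x" for x
    by (rule gradient_eqI) (simp add: gderiv_def p_eq has_derivative_cub)
  then have grad_eq: "gradient p = grad" by blast
  have hess_eq: "hessian p x = matrix (hess x)" for x
    unfolding hessian_def grad_eq jacobian_def
    using frechet_derivative_at[OF has_derivative_grad[of x]] by simp
  have hess_mult: "matrix (hess x) *v v = hess x v" for x v
    by (rule fun_cong[OF matrix_vector_mul(2)[OF linear_hess]])
  \<comment> \<open>The symmetry demanded by \<open>pos_semidef\<close> is self-adjointness of
    \<open>hess x\<close>, which holds at every point.\<close>
  have "transpose (matrix (hess x)) = matrix (hess x)" for x
  proof -
    have "adjoint (hess x) = hess x"
      by (rule adjoint_unique) (simp add: hess_sym)
    then show ?thesis using matrix_adjoint[OF linear_hess[of x]] by simp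
  qed
  then have psd_eq: "pos_semidef (hessian p x) \<longleftrightarrow> psd x" for x
    by (simp add: pos_semidef_def hess_eq hess_mult psd_def inner_commute)
  have "local_minima p = LM" "second_order_points p = SO"
    "critical_points p = crit" "convexity_region p = CR"
    by (simp_all add: local_minima_def LM_def second_order_points_def SO_def critical_points_def
        crit_def convexity_region_def CR_def grad_eq psd_eq) (simp add: p_eq)
  then show ?thesis using local_minima_rel_interior assms(2) by simp
qed

end
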